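(* Let $K$ be a field of characteristic $\neq 2$ and let $N$ be an indecomposable associative nil evolution $K$-algebra of dimension $n\geq 3$ with $\dim(\mathrm{ann}(N))=1$. Let $\{e_1,\dots,e_n\}$ be a natural basis of $N$ with $\mathrm{ann}(N)=Ke_n$, so that $e_i^2=\alpha_ie_n$ with $\alpha_i\in K\setminus\{0\}$ for $1\le i\le n-1$ and $e_n^2=0$. Let $e_{ji}$ denote the endomorphism of $N$ sending $e_i$ to $e_j$ and the other basis vectors to $0$. Let $a=\sum_{i=1}^na_ie_i\in N$ and let $R_a:N\to N$, $x\mapsto xa$. Then $R_a$ is a derivation if and only if $R_a=\sum_{i=1}^{n-1}\alpha_ia_ie_{ni}$. Moreover $\mathfrak{I}(N)=L\simeq K^{n-1}$, where $L=\langle e_{nj}\;;\;1\le j\le n-1\rangle$ is the linear span.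
   Context: An evolution $K$-algebra is a finite-dimensional commutative (not necessarily associative) $K$-algebra with a basis $\{e_1,\dots,e_n\}$ (a natural basis) such that $e_ie_j=0$ for $i\neq j$. It is nil if for every $a$ some power $a^m$ is $0$; indecomposable if it is not a direct sum of two nonzero ideals; $\mathrm{ann}(N)=\{x\in N:xN=0\}$. It is a known fact that in an associative nil evolution algebra the square of every natural basis vector lies in $\mathrm{ann}(N)$, which gives the stated multiplication. A derivation of $N$ is a linear map $d:N\to N$ with $d(uv)=ud(v)+d(u)v$; $\mathfrak{D}(N)$ is the space of derivations. For a commutative associative algebra $N$, the space of inner derivations is $\mathfrak{I}(N)=\mathfrak{D}(N)\cap R(N)$, where $R(N)=\{R_a: a\in N\}$. *)

theory Defs
  imports
    "HOL-Library.Function_Algebras"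
    "Jordan_Normal_Form.Matrix"
begin

text \<open>An algebra has the whole type \<open>'v\<close> as its underlying vector space.\<close>

locale comm_algebra = vector_space scale
  for scale :: "'k::field \<Rightarrow> 'v::ab_group_add \<Rightarrow> 'v" +
  fixes mul :: "'v \<Rightarrow> 'v \<Rightarrow> 'v"
  assumes mul_commute: "mul x y = mul y x"
    and mul_add_left: "mul (x + y) z = mul x z + mul y z"
    and mul_scale_left: "mul (scale c x) y = scale c (mul x y)"

definition natural_basis ::
  "('k::field \<Rightarrow> 'v::ab_group_add \<Rightarrow> 'v) \<Rightarrow> ('v \<Rightarrow> 'v \<Rightarrow> 'v) \<Rightarrow> nat \<Rightarrow> (nat \<Rightarrow> 'v) \<Rightarrow> bool"
  where "natural_basis scale mul n e \<longleftrightarrow>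
    inj_on e {1..n} \<and>
    \<not> Modules.module.dependent scale (e ` {1..n}) \<and>
    Modules.module.span scale (e ` {1..n}) = UNIV \<and>
    (\<forall>i\<in>{1..n}. \<forall>j\<in>{1..n}. i \<noteq> j \<longrightarrow> mul (e i) (e j) = 0)"

text \<open>Finite-dimensionality is part of the existence of a finite natural basis.\<close>

locale evolution_algebra = comm_algebra scale mul
  for scale :: "'k::field \<Rightarrow> 'v::ab_group_add \<Rightarrow> 'v" and mul :: "'v \<Rightarrow> 'v \<Rightarrow> 'v" +
  assumes ex_natural_basis: "\<exists>n e. natural_basis scale mul n e"

definition associative_mult :: "('v \<Rightarrow> 'v \<Rightarrow> 'v) \<Rightarrow> bool"
  where "associative_mult mul \<longleftrightarrow> (\<forall>x y z. mul (mul x y) z = mul x (mul y z))"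

text \<open>There is no unit, so powers start at exponent 1 (and exponent 0 is meaningless):
  \<open>a\<^sup>1 = a\<close> and \<open>a\<^sup>m\<^sup>+\<^sup>1 = a\<^sup>m a\<close>.\<close>

definition alg_power :: "('v \<Rightarrow> 'v \<Rightarrow> 'v) \<Rightarrow> 'v \<Rightarrow> nat \<Rightarrow> 'v"
  where "alg_power mul a m = ((\<lambda>x. mul x a) ^^ (m - 1)) a"

definition nil_algebra :: "('v::zero \<Rightarrow> 'v \<Rightarrow> 'v) \<Rightarrow> bool"
  where "nil_algebra mul \<longleftrightarrow> (\<forall>a. \<exists>m\<ge>1. alg_power mul a m = 0)"

text \<open>One-sided absorption suffices for ideals, as the multiplication is commutative.\<close>

definition alg_ideal ::
  "('k::field \<Rightarrow> 'v::ab_group_add \<Rightarrow> 'v) \<Rightarrow> ('v \<Rightarrow> 'v \<Rightarrow> 'v) \<Rightarrow> 'v set \<Rightarrow> bool"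
  where "alg_ideal scale mul I \<longleftrightarrow>
    Modules.module.subspace scale I \<and> (\<forall>x\<in>I. \<forall>y. mul x y \<in> I)"

definition indecomposable_algebra ::
  "('k::field \<Rightarrow> 'v::ab_group_add \<Rightarrow> 'v) \<Rightarrow> ('v \<Rightarrow> 'v \<Rightarrow> 'v) \<Rightarrow> bool"
  where "indecomposable_algebra scale mul \<longleftrightarrow>
    \<not> (\<exists>I J. alg_ideal scale mul I \<and> alg_ideal scale mul J \<and>
        I \<noteq> {0} \<and> J \<noteq> {0} \<and> I \<inter> J = {0} \<and>
        {x + y | x y. x \<in> I \<and> y \<in> J} = UNIV)"

definition alg_ann :: "('v::zero \<Rightarrow> 'v \<Rightarrow> 'v) \<Rightarrow> 'v set"
  where "alg_ann mul = {x. \<forall>y. mul x y = 0}"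

definition derivations ::
  "('k::field \<Rightarrow> 'v::ab_group_add \<Rightarrow> 'v) \<Rightarrow> ('v \<Rightarrow> 'v \<Rightarrow> 'v) \<Rightarrow> ('v \<Rightarrow> 'v) set"
  where "derivations scale mul =
    {d. Vector_Spaces.linear scale scale d \<and>
        (\<forall>u v. d (mul u v) = mul u (d v) + mul (d u) v)}"

definition right_mult :: "('v \<Rightarrow> 'v \<Rightarrow> 'v) \<Rightarrow> 'v \<Rightarrow> 'v \<Rightarrow> 'v"
  where "right_mult mul a = (\<lambda>x. mul x a)"

definition inner_derivations ::
  "('k::field \<Rightarrow> 'v::ab_group_add \<Rightarrow> 'v) \<Rightarrow> ('v \<Rightarrow> 'v \<Rightarrow> 'v) \<Rightarrow> ('v \<Rightarrow> 'v) set"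
  where "inner_derivations scale mul = derivations scale mul \<inter> range (right_mult mul)"

text \<open>Addition of maps is the pointwise one of \<^theory>\<open>HOL-Library.Function_Algebras\<close>;
  this is the corresponding scalar multiplication.\<close>

definition map_scale :: "('k \<Rightarrow> 'v \<Rightarrow> 'v) \<Rightarrow> 'k \<Rightarrow> ('v \<Rightarrow> 'v) \<Rightarrow> 'v \<Rightarrow> 'v"
  where "map_scale scale c f = (\<lambda>x. scale c (f x))"

lemma vector_space_map_scale:
  assumes "vector_space scale"
  shows "vector_space (map_scale scale)"
proof -
  interpret vector_space scale by fact
  show ?thesis
    by unfold_locales
      (auto simp: map_scale_def fun_eq_iff scale_right_distrib scale_left_distrib)
qed

text \<open>\<open>unit_endo scale n e j i\<close> is the endomorphism \<open>e\<^sub>j\<^sub>i\<close>, sending \<open>e\<^sub>i\<close> to \<open>e\<^sub>j\<close>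
  (first index: target) and the other basis vectors to 0.\<close>

definition unit_endo ::
  "('k::field \<Rightarrow> 'v::ab_group_add \<Rightarrow> 'v) \<Rightarrow> nat \<Rightarrow> (nat \<Rightarrow> 'v) \<Rightarrow> nat \<Rightarrow> nat \<Rightarrow> 'v \<Rightarrow> 'v"
  where "unit_endo scale n e j i =
    vector_space_pair.construct scale scale (e ` {1..n}) (\<lambda>v. if v = e i then e j else 0)"

lemma unit_endo:
  assumes "comm_algebra scale mul" "natural_basis scale mul n e" "i \<in> {1..n}"
  shows "Vector_Spaces.linear scale scale (unit_endo scale n e j i)"
    and "k \<in> {1..n} \<Longrightarrow> unit_endo scale n e j i (e k) = (if k = i then e j else 0)"
proof -
  interpret comm_algebra scale mul by fact
  interpret p: vector_space_pair scale scale ..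
  have indep: "\<not> dependent (e ` {1..n})" and inj: "inj_on e {1..n}"
    using assms(2) by (auto simp: natural_basis_def)
  show "Vector_Spaces.linear scale scale (unit_endo scale n e j i)"
    unfolding unit_endo_def by (rule p.linear_construct[OF indep])
  show "unit_endo scale n e j i (e k) = (if k = i then e j else 0)" if "k \<in> {1..n}"
    unfolding unit_endo_def using p.construct_basis[OF indep, of "e k"] that inj assms(3)
    by (auto simp: inj_on_eq_iff)
qed

text \<open>Linear isomorphism of vector spaces given by carrier sets, so that \<open>K\<^sup>m\<close> can be
  taken to be \<^term>\<open>carrier_vec m\<close>.\<close>

definition linearly_isomorphic ::
  "('k \<Rightarrow> 'a::plus \<Rightarrow> 'a) \<Rightarrow> 'a set \<Rightarrow> ('k \<Rightarrow> 'b::plus \<Rightarrow> 'b) \<Rightarrow> 'b set \<Rightarrow> bool"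
  where "linearly_isomorphic s1 U s2 V \<longleftrightarrow>
    (\<exists>\<phi>. bij_betw \<phi> U V \<and>
      (\<forall>x\<in>U. \<forall>y\<in>U. \<phi> (x + y) = \<phi> x + \<phi> y) \<and>
      (\<forall>c. \<forall>x\<in>U. \<phi> (s1 c x) = s2 c (\<phi> x)))"

end

theory Submission
  imports Defs
begin

text \<open>
  Since a product of distinct natural basis vectors vanishes, multiplying by \<open>e j\<close> only sees the
  \<open>e j\<close>-coordinate, so every product \<open>w (e j)\<close> is a multiple of \<open>(e j)\<^sup>2\<close>. For \<open>w = (e j)\<^sup>2\<close> the
  multiplier must vanish because \<open>e j\<close> is nilpotent, and associativity gives
  \<open>(e i)\<^sup>2 (e j) = (e i) ((e i) (e j)) = 0\<close> for \<open>i \<noteq> j\<close>. Hence all squares of basis vectors, and with them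
  all products, lie in the annihilator (lemmas \<open>natural_basis_square_in_ann\<close> and \<open>mul_in_ann\<close>).

  A product of three elements is therefore zero, both sides of the Leibniz rule for a multiplication
  operator \<open>R\<^sub>a\<close> are zero, and \<^emph>\<open>every\<close> \<open>R\<^sub>a\<close> is a derivation. Likewise the displayed formula for \<open>R\<^sub>a\<close>
  holds for every \<open>a\<close>: as \<open>a \<mapsto> R\<^sub>a\<close> is linear, it is enough to know that \<open>R\<^sub>a\<close> is \<open>\<alpha>\<^sub>i e\<^sub>n\<^sub>i\<close> for
  \<open>a = e i\<close> with \<open>i < n\<close>, and zero for \<open>a = e n\<close>. So the stated equivalence has two true sides.

  Consequently the inner derivations are all the multiplication operators, that is, the span of
  the \<open>\<alpha>\<^sub>i e\<^sub>n\<^sub>i\<close>. The \<open>\<alpha>\<^sub>i\<close> are nonzero, since otherwise \<open>e i\<close> would annihilate the algebra and be a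
  multiple of \<open>e n\<close>; so this span is the span \<open>L\<close> of the \<open>e\<^sub>n\<^sub>i\<close>. Evaluating at the basis vectors shows that these are
  linearly independent, and taking coordinates identifies \<open>L\<close> with \<open>K\<^sup>n\<^sup>-\<^sup>1\<close>.
\<close>

section \<open>Coordinates on the span of a finite independent family\<close>

lemma sum_fun_apply: "(\<Sum>i\<in>A. f i) x = (\<Sum>i\<in>A. f i x)"
  by (induction A rule: infinite_finite_induct) auto

context vector_space
begin

text \<open>Entries of vectors are numbered from 0 and the family from 1, hence the shift by \<open>Suc\<close>.\<close>

lemma span_linearly_isomorphic_carrier_vec:
  assumes inj: "inj_on b {1..m}" and indep: "independent (b ` {1..m})"
  shows "linearly_isomorphic scale (span (b ` {1..m})) smult_vec (carrier_vec m)"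
proof -
  let ?B = "b ` {1..m}"
  define \<phi> where "\<phi> x = vec m (\<lambda>j. representation ?B x (b (Suc j)))" for x
  have "bij_betw \<phi> (span ?B) (carrier_vec m)"
  proof (rule bij_betwI')
    fix x y assume x: "x \<in> span ?B" and y: "y \<in> span ?B"
    have "x = y" if "\<phi> x = \<phi> y"
    proof -
      have "representation ?B x (b i) = representation ?B y (b i)" if i: "i \<in> {1..m}" for i
      proof -
        obtain j where j: "i = Suc j" "j < m" using i by (cases i) auto
        have "\<phi> x $ j = \<phi> y $ j" using \<open>\<phi> x = \<phi> y\<close> by simp
        then show ?thesis using j by (simp add: \<phi>_def)
      qed
      then have "(\<Sum>v\<in>?B. scale (representation ?B x v) v) = (\<Sum>v\<in>?B. scale (representation ?B y v) v)"
        by (intro sum.cong) auto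
      then show ?thesis
        using sum_representation_eq[OF indep x, of ?B] sum_representation_eq[OF indep y, of ?B] by simp
    qed
    then show "(\<phi> x = \<phi> y) = (x = y)" by auto
  next
    fix x show "\<phi> x \<in> carrier_vec m" by (simp add: \<phi>_def)
  next
    fix v :: "'a vec" assume v: "v \<in> carrier_vec m"
    define x where "x = (\<Sum>i = 1..m. scale (v $ (i - 1)) (b i))"
    have x: "x \<in> span ?B"
      unfolding x_def by (intro span_sum span_scale span_base) auto
    have "representation ?B x (b (Suc j)) = v $ j" if j: "j < m" for j
    proof -
      have "representation ?B x (b (Suc j)) =
          (\<Sum>i = 1..m. representation ?B (scale (v $ (i - 1)) (b i)) (b (Suc j)))"
        unfolding x_def
        by (rule representation_sum[OF indep, THEN fun_cong]) (rule span_scale, rule span_base, rule imageI)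
      also have "\<dots> = (\<Sum>i = 1..m. if i = Suc j then v $ j else 0)"
      proof (rule sum.cong[OF refl])
        fix i assume i: "i \<in> {1..m}"
        then have bi: "b i \<in> ?B" by blast
        have "b i = b (Suc j) \<longleftrightarrow> i = Suc j"
          using inj i j by (auto simp: inj_on_eq_iff)
        then show "representation ?B (scale (v $ (i - 1)) (b i)) (b (Suc j)) = (if i = Suc j then v $ j else 0)"
          by (auto simp: representation_scale[OF indep span_base[OF bi]] representation_basis[OF indep bi]
              simp del: One_nat_def)
      qed
      also have "\<dots> = v $ j" using j by simp
      finally show ?thesis .
    qed
    then have "v = \<phi> x"
      using v by (intro eq_vecI) (auto simp: \<phi>_def)
    with x show "\<exists>x\<in>span ?B. v = \<phi> x" by blast
  qed
  moreover have "\<phi> (x + y) = \<phi> x + \<phi> y" if "x \<in> span ?B" "y \<in> span ?B" for x y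
    by (intro eq_vecI) (simp_all add: \<phi>_def representation_add[OF indep that(2) that(1)] del: One_nat_def)
  moreover have "\<phi> (scale c x) = c \<cdot>\<^sub>v \<phi> x" if "x \<in> span ?B" for c x
    by (intro eq_vecI) (simp_all add: \<phi>_def representation_scale[OF indep that] del: One_nat_def)
  ultimately show ?thesis
    unfolding linearly_isomorphic_def by blast
qed

end

section \<open>Products in associative nil evolution algebras\<close>

context comm_algebra
begin

lemma vector_space_scale: "vector_space scale"
  by unfold_locales

lemma linear_mul_left: "Vector_Spaces.linear scale scale (\<lambda>x. mul x y)"
  unfolding Vector_Spaces.linear_iff using vector_space_scale by (simp add: mul_add_left mul_scale_left)

lemma mul_zero_left: "mul 0 y = 0"
  using mul_add_left[of 0 0 y] by simp

lemma mul_zero_right: "mul y 0 = 0"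
  using mul_zero_left mul_commute by metis

lemma mul_scale_right: "mul x (scale c y) = scale c (mul x y)"
  using mul_scale_left mul_commute by metis

lemma mul_add_right: "mul x (y + z) = mul x y + mul x z"
  using mul_add_left mul_commute by metis

lemma linear_right_mult: "Vector_Spaces.linear scale (map_scale scale) (right_mult mul)"
  unfolding Vector_Spaces.linear_iff right_mult_def
  using vector_space_scale vector_space_map_scale[OF vector_space_scale]
  by (simp add: mul_add_right mul_scale_right fun_eq_iff map_scale_def)

lemma subspace_alg_ann: "subspace (alg_ann mul)"
  by (rule subspaceI) (auto simp: alg_ann_def mul_zero_left mul_add_left mul_scale_left)

lemma linear_eq_on_natural_basis:
  assumes nb: "natural_basis scale mul n e"
    and f: "Vector_Spaces.linear scale scale f" and g: "Vector_Spaces.linear scale scale g"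
    and eq: "\<And>i. i \<in> {1..n} \<Longrightarrow> f (e i) = g (e i)"
  shows "f = g"
proof
  fix x
  interpret p: vector_space_pair scale scale ..
  have "x \<in> span (e ` {1..n})"
    using nb by (simp add: natural_basis_def)
  then show "f x = g x"
    by (rule p.linear_eq_on[OF f g]) (auto simp: eq)
qed

lemma in_ann_if_natural_basis:
  assumes nb: "natural_basis scale mul n e"
    and zero: "\<And>j. j \<in> {1..n} \<Longrightarrow> mul x (e j) = 0"
  shows "x \<in> alg_ann mul"
proof -
  interpret p: vector_space_pair scale scale ..
  have "(\<lambda>y. mul y x) = (\<lambda>y. 0)"
    by (rule linear_eq_on_natural_basis[OF nb linear_mul_left p.linear_zero])
      (simp add: zero mul_commute[of _ x])
  then show ?thesis
    by (auto simp: alg_ann_def fun_eq_iff mul_commute[of x])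
qed

text \<open>Multiplication by \<open>e j\<close> kills all coordinates other than the one at \<open>e j\<close>.\<close>

lemma mul_natural_basis_is_multiple_of_square:
  assumes nb: "natural_basis scale mul n e" and j: "j \<in> {1..n}"
  shows "\<exists>c. mul w (e j) = scale c (mul (e j) (e j))"
proof -
  have "w \<in> span (e ` {1..n})"
    using nb by (simp add: natural_basis_def)
  then have "mul w (e j) \<in> span {mul (e j) (e j)}"
  proof (induction rule: span_induct_alt)
    case base
    show ?case by (simp add: mul_zero_left span_zero)
  next
    case (step c x y)
    from step(1) obtain i where i: "i \<in> {1..n}" "x = e i" by auto
    have "mul x (e j) \<in> span {mul (e j) (e j)}"
    proof (cases "i = j")
      case True
      then show ?thesis using i by (simp add: span_base)
    next
      case False
      then have "mul x (e j) = 0" using nb i j by (simp add: natural_basis_def)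
      then show ?thesis by (simp add: span_zero)
    qed
    with step show ?case
      by (simp add: mul_add_left mul_scale_left span_add span_scale)
  qed
  then show ?thesis by (auto simp: span_singleton)
qed

text \<open>If \<open>a\<^sup>3 = c a\<^sup>2\<close>, then \<open>a\<^sup>m = c\<^sup>m\<^sup>-\<^sup>2 a\<^sup>2\<close> for \<open>m \<ge> 2\<close>, so that nilpotency forces \<open>c = 0\<close> or \<open>a\<^sup>2 = 0\<close>.\<close>

lemma nil_cube_eq_0:
  assumes nil: "nil_algebra mul" and c: "mul (mul a a) a = scale c (mul a a)"
  shows "mul (mul a a) a = 0"
proof -
  obtain m where m: "m \<ge> 1" "alg_power mul a m = 0"
    using nil by (auto simp: nil_algebra_def)
  have pow: "((\<lambda>x. mul x a) ^^ k) (mul a a) = scale (c ^ k) (mul a a)" for k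
    by (induction k) (simp_all add: mul_scale_left c mult.commute)
  show ?thesis
  proof (cases "m = 1")
    case True
    then have "a = 0" using m by (simp add: alg_power_def)
    then show ?thesis by (simp add: mul_zero_left)
  next
    case False
    then obtain k where k: "m - 1 = Suc k" using m(1) by (cases "m - 1") auto
    have "scale (c ^ k) (mul a a) = 0"
      using m(2) pow[of k] unfolding alg_power_def k funpow_Suc_right by simp
    then have "c = 0 \<or> mul a a = 0" by auto
    then show ?thesis using c by (auto simp: mul_zero_left)
  qed
qed

lemma natural_basis_square_in_ann:
  assumes nb: "natural_basis scale mul n e" and assoc: "associative_mult mul"
    and nil: "nil_algebra mul" and i: "i \<in> {1..n}"
  shows "mul (e i) (e i) \<in> alg_ann mul"
proof (rule in_ann_if_natural_basis[OF nb])
  fix j assume j: "j \<in> {1..n}"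
  show "mul (mul (e i) (e i)) (e j) = 0"
  proof (cases "i = j")
    case True
    obtain c where "mul (mul (e i) (e i)) (e i) = scale c (mul (e i) (e i))"
      using mul_natural_basis_is_multiple_of_square[OF nb i] by blast
    then show ?thesis using nil_cube_eq_0[OF nil] True by blast
  next
    case False
    then have "mul (e i) (e j) = 0" using nb i j by (simp add: natural_basis_def)
    then show ?thesis using assoc by (simp add: associative_mult_def mul_zero_right)
  qed
qed

lemma mul_in_ann:
  assumes nb: "natural_basis scale mul n e" and assoc: "associative_mult mul"
    and nil: "nil_algebra mul"
  shows "mul x y \<in> alg_ann mul"
proof -
  have "y \<in> span (e ` {1..n})"
    using nb by (simp add: natural_basis_def)
  then show ?thesis
  proof (induction rule: span_induct_alt)
    case base
    show ?case by (simp add: mul_zero_right subspace_0 subspace_alg_ann)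
  next
    case (step c z y)
    then obtain j where j: "j \<in> {1..n}" "z = e j" by auto
    obtain k where "mul x z = scale k (mul (e j) (e j))"
      using mul_natural_basis_is_multiple_of_square[OF nb j(1)] j(2) by blast
    then have "mul x z \<in> alg_ann mul"
      using natural_basis_square_in_ann[OF nb assoc nil j(1)]
      by (simp add: subspace_scale subspace_alg_ann)
    with step show ?case
      by (simp add: mul_add_right mul_scale_right subspace_add subspace_scale subspace_alg_ann)
  qed
qed

section \<open>Multiplication operators\<close>

lemma right_mult_derivation_if_products_in_ann:
  assumes "\<And>x y. mul x y \<in> alg_ann mul"
  shows "right_mult mul a \<in> derivations scale mul"
proof -
  have "mul (mul x y) z = 0" "mul z (mul x y) = 0" for x y z
    using assms mul_commute[of z] by (auto simp: alg_ann_def)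
  then show ?thesis
    using linear_mul_left by (simp add: derivations_def right_mult_def)
qed

lemma right_mult_natural_basis:
  assumes nb: "natural_basis scale mul n e" and i: "i \<in> {1..n}"
    and sq: "mul (e i) (e i) = scale c (e m)"
  shows "right_mult mul (e i) = map_scale scale c (unit_endo scale n e m i)"
proof (rule linear_eq_on_natural_basis[OF nb])
  interpret p: vector_space_pair scale scale ..
  have alg: "comm_algebra scale mul" by unfold_locales
  show "Vector_Spaces.linear scale scale (right_mult mul (e i))"
    using linear_mul_left by (simp add: right_mult_def)
  show "Vector_Spaces.linear scale scale (map_scale scale c (unit_endo scale n e m i))"
    unfolding map_scale_def by (rule p.linear_compose_scale_right[OF unit_endo(1)[OF alg nb i]])
  fix k assume k: "k \<in> {1..n}"
  show "right_mult mul (e i) (e k) = map_scale scale c (unit_endo scale n e m i) (e k)"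
    using nb i k by (simp add: unit_endo(2)[OF alg nb i] map_scale_def right_mult_def sq natural_basis_def)
qed

text \<open>Evaluation at \<open>e k\<close> sends \<open>e\<^sub>m\<^sub>k\<close> to \<open>e m\<close> and all other \<open>e\<^sub>m\<^sub>j\<close> to zero.\<close>

lemma unit_endo_independent:
  assumes nb: "natural_basis scale mul n e" and m: "m \<in> {1..n}" and J: "J \<subseteq> {1..n}"
  shows "inj_on (unit_endo scale n e m) J"
    and "\<not> Modules.module.dependent (map_scale scale) (unit_endo scale n e m ` J)"
proof -
  interpret E: vector_space "map_scale scale"
    by (rule vector_space_map_scale[OF vector_space_scale])
  have alg: "comm_algebra scale mul" by unfold_locales
  have em: "e m \<noteq> 0"
    using nb m dependent_zero[of "e ` {1..n}"] by (force simp: natural_basis_def)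
  have ev: "unit_endo scale n e m j (e k) = (if k = j then e m else 0)" if "j \<in> J" "k \<in> J" for j k
    using unit_endo(2)[OF alg nb, of j k m] subsetD[OF J that(1)] subsetD[OF J that(2)] by auto
  show inj: "inj_on (unit_endo scale n e m) J"
  proof (rule inj_onI)
    fix j k assume jk: "j \<in> J" "k \<in> J" "unit_endo scale n e m j = unit_endo scale n e m k"
    then have "unit_endo scale n e m k (e j) = e m"
      using ev[of j j] by simp
    then show "j = k" using ev[of k j] jk em by (auto split: if_splits)
  qed
  have fin: "finite J" using J finite_subset by blast
  have "u (unit_endo scale n e m k) = 0"
    if k: "k \<in> J" and u: "(\<Sum>v\<in>unit_endo scale n e m ` J. map_scale scale (u v) v) = 0" for u k
  proof -
    have "0 = (\<Sum>j\<in>J. map_scale scale (u (unit_endo scale n e m j)) (unit_endo scale n e m j)) (e k)"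
      using u by (simp add: sum.reindex[OF inj])
    also have "\<dots> = (\<Sum>j\<in>J. if j = k then scale (u (unit_endo scale n e m k)) (e m) else 0)"
      unfolding sum_fun_apply by (intro sum.cong) (auto simp: map_scale_def ev k)
    also have "\<dots> = scale (u (unit_endo scale n e m k)) (e m)"
      using fin k by simp
    finally show ?thesis using em by simp
  qed
  then show "\<not> E.dependent (unit_endo scale n e m ` J)"
    using fin by (auto simp: E.dependent_finite)
qed

text \<open>This is where the structure constants have to be nonzero: each \<open>e\<^sub>n\<^sub>i\<close> is then itself the
  multiplication operator of a multiple of \<open>e i\<close>.\<close>

lemma range_right_mult_eq_span_unit_endo:
  assumes nb: "natural_basis scale mul n e"
    and sq: "\<And>i. i \<in> {1..n - 1} \<Longrightarrow> \<alpha> i \<noteq> 0 \<and> mul (e i) (e i) = scale (\<alpha> i) (e n)"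
    and en: "right_mult mul (e n) = 0"
  shows "range (right_mult mul) =
    Modules.module.span (map_scale scale) (unit_endo scale n e n ` {1..n - 1})"
proof -
  interpret E: vector_space "map_scale scale"
    by (rule vector_space_map_scale[OF vector_space_scale])
  interpret p: vector_space_pair scale "map_scale scale" ..
  have R: "right_mult mul (e i) = map_scale scale (\<alpha> i) (unit_endo scale n e n i)"
    if "i \<in> {1..n - 1}" for i
    using right_mult_natural_basis[OF nb, of i "\<alpha> i" n] sq[OF that] that by auto
  have "range (right_mult mul) = right_mult mul ` span (e ` {1..n})"
    using nb by (simp add: natural_basis_def)
  also have "\<dots> = E.span (right_mult mul ` e ` {1..n})"
    by (rule p.linear_span_image[OF linear_right_mult, symmetric])
  also have "\<dots> = E.span (unit_endo scale n e n ` {1..n - 1})"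
  proof (rule E.span_eq[THEN iffD2], intro conjI subsetI)
    fix f assume "f \<in> right_mult mul ` e ` {1..n}"
    then obtain i where i: "i \<in> {1..n}" "f = right_mult mul (e i)" by auto
    show "f \<in> E.span (unit_endo scale n e n ` {1..n - 1})"
    proof (cases "i = n")
      case True
      then show ?thesis using i en E.span_zero by simp
    next
      case False
      then have "i \<in> {1..n - 1}" using i by auto
      then show ?thesis using i(2) by (simp add: R E.span_scale E.span_base)
    qed
  next
    fix f assume "f \<in> unit_endo scale n e n ` {1..n - 1}"
    then obtain i where i: "i \<in> {1..n - 1}" "f = unit_endo scale n e n i" by auto
    have "f = map_scale scale (inverse (\<alpha> i)) (right_mult mul (e i))"
      using sq[OF i(1)] i by (simp add: R)
    moreover have "right_mult mul (e i) \<in> right_mult mul ` e ` {1..n}"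
      using i(1) by auto
    ultimately show "f \<in> E.span (right_mult mul ` e ` {1..n})"
      by (simp add: E.span_scale E.span_base)
  qed
  finally show ?thesis .
qed

text \<open>A basis vector with zero square annihilates the algebra, but \<open>e n\<close> is the only one that
  lies on the annihilator line.\<close>

lemma natural_basis_structure_constants:
  assumes nb: "natural_basis scale mul n e" and assoc: "associative_mult mul"
    and nil: "nil_algebra mul" and ann: "alg_ann mul = span {e n}"
  shows "\<exists>\<alpha>. \<forall>i\<in>{1..n - 1}. \<alpha> i \<noteq> 0 \<and> mul (e i) (e i) = scale (\<alpha> i) (e n)"
proof (rule bchoice, rule ballI)
  fix i assume i: "i \<in> {1..n - 1}"
  then have i': "i \<in> {1..n}" "n \<in> {1..n}" "i \<noteq> n" by auto
  obtain c where c: "mul (e i) (e i) = scale c (e n)"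
    using natural_basis_square_in_ann[OF nb assoc nil i'(1)] by (auto simp: ann span_singleton)
  have "c \<noteq> 0"
  proof
    assume "c = 0"
    then have "mul (e i) (e j) = 0" if "j \<in> {1..n}" for j
      using c nb i'(1) that by (cases "j = i") (simp_all add: natural_basis_def)
    then have "e i \<in> span {e n}"
      unfolding ann[symmetric] by (rule in_ann_if_natural_basis[OF nb])
    moreover have "{e n} \<subseteq> e ` {1..n} - {e i}"
      using nb i' by (auto simp: natural_basis_def inj_on_eq_iff)
    ultimately have "e i \<in> span (e ` {1..n} - {e i})"
      using span_mono by blast
    then have "dependent (e ` {1..n})"
      using i'(1) by (auto simp: dependent_def)
    then show False using nb by (simp add: natural_basis_def)
  qed
  with c show "\<exists>c. c \<noteq> 0 \<and> mul (e i) (e i) = scale c (e n)" by blast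
qed

end

section \<open>Inner derivations\<close>

theorem proposition4p2p3:
  fixes scale :: "'k::field \<Rightarrow> 'v::ab_group_add \<Rightarrow> 'v"
    and mul :: "'v \<Rightarrow> 'v \<Rightarrow> 'v"
    and n :: nat
    and e :: "nat \<Rightarrow> 'v"
    and L :: "('v \<Rightarrow> 'v) set"
  assumes "CHAR('k) \<noteq> 2"
    and "evolution_algebra scale mul"
    and "associative_mult mul"
    and "nil_algebra mul"
    and "indecomposable_algebra scale mul"
    and "vector_space.dim scale (UNIV :: 'v set) = n"
    and "n \<ge> 3"
    and "vector_space.dim scale (alg_ann mul) = 1"
    and "natural_basis scale mul n e"
    and "alg_ann mul = Modules.module.span scale {e n}"
    and L_def: "L = Modules.module.span (map_scale scale) {unit_endo scale n e n j | j. j \<in> {1..n - 1}}"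
  shows "(\<exists>\<alpha> :: nat \<Rightarrow> 'k.
      (\<forall>i\<in>{1..n - 1}. \<alpha> i \<noteq> 0 \<and> mul (e i) (e i) = scale (\<alpha> i) (e n)) \<and>
      mul (e n) (e n) = 0 \<and>
      (\<forall>a :: nat \<Rightarrow> 'k.
        right_mult mul (\<Sum>i = 1..n. scale (a i) (e i)) \<in> derivations scale mul \<longleftrightarrow>
        right_mult mul (\<Sum>i = 1..n. scale (a i) (e i)) =
          (\<Sum>i = 1..n - 1. map_scale scale (\<alpha> i * a i) (unit_endo scale n e n i)))) \<and>
    inner_derivations scale mul = L \<and>
    linearly_isomorphic (map_scale scale) L (smult_vec :: 'k \<Rightarrow> 'k vec \<Rightarrow> 'k vec) (carrier_vec (n - 1))"
proof -
  interpret evolution_algebra scale mul by fact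
  interpret E: vector_space "map_scale scale"
    by (rule vector_space_map_scale[OF vector_space_scale])
  interpret p: vector_space_pair scale "map_scale scale" ..
  note nb = \<open>natural_basis scale mul n e\<close> and assoc = \<open>associative_mult mul\<close>
    and nil = \<open>nil_algebra mul\<close> and ann = \<open>alg_ann mul = span {e n}\<close>
  have n: "n \<in> {1..n}" using \<open>n \<ge> 3\<close> by simp
  obtain \<alpha> where \<alpha>: "\<And>i. i \<in> {1..n - 1} \<Longrightarrow> \<alpha> i \<noteq> 0 \<and> mul (e i) (e i) = scale (\<alpha> i) (e n)"
    using natural_basis_structure_constants[OF nb assoc nil ann] by blast
  have "e n \<in> alg_ann mul" by (simp add: ann span_base)
  then have en: "mul (e n) x = 0" for x by (simp add: alg_ann_def)
  then have Ren: "right_mult mul (e n) = 0"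
    by (simp add: right_mult_def fun_eq_iff mul_commute[of _ "e n"])
  have deriv: "right_mult mul a \<in> derivations scale mul" for a
    using right_mult_derivation_if_products_in_ann mul_in_ann[OF nb assoc nil] by blast
  have formula: "right_mult mul (\<Sum>i = 1..n. scale (a i) (e i)) =
      (\<Sum>i = 1..n - 1. map_scale scale (\<alpha> i * a i) (unit_endo scale n e n i))" for a
  proof -
    have "right_mult mul (\<Sum>i = 1..n. scale (a i) (e i)) =
        (\<Sum>i = 1..n. map_scale scale (a i) (right_mult mul (e i)))"
      by (simp only: p.linear_sum[OF linear_right_mult] p.linear_scale[OF linear_right_mult])
    also have "\<dots> = (\<Sum>i = 1..n - 1. map_scale scale (a i) (right_mult mul (e i)))"
    proof (intro sum.mono_neutral_right ballI)
      fix i assume "i \<in> {1..n} - {1..n - 1}"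
      then have "i = n" by auto
      then show "map_scale scale (a i) (right_mult mul (e i)) = 0"
        using Ren by simp
    qed auto
    also have "\<dots> = (\<Sum>i = 1..n - 1. map_scale scale (\<alpha> i * a i) (unit_endo scale n e n i))"
    proof (rule sum.cong[OF refl])
      fix i assume i: "i \<in> {1..n - 1}"
      then show "map_scale scale (a i) (right_mult mul (e i)) =
          map_scale scale (\<alpha> i * a i) (unit_endo scale n e n i)"
        using right_mult_natural_basis[OF nb, of i "\<alpha> i" n] \<alpha>[OF i]
        by (auto simp: mult.commute)
    qed
    finally show ?thesis .
  qed
  have L: "L = E.span (unit_endo scale n e n ` {1..n - 1})"
    unfolding L_def by (rule arg_cong[where f = E.span]) auto
  have "inner_derivations scale mul = range (right_mult mul)"
    using deriv by (auto simp: inner_derivations_def)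
  then have inner: "inner_derivations scale mul = L"
    using range_right_mult_eq_span_unit_endo[OF nb \<alpha> Ren] L by simp
  have "{1..n - 1} \<subseteq> {1..n}" by auto
  then have iso: "linearly_isomorphic (map_scale scale) L smult_vec (carrier_vec (n - 1))"
    unfolding L
    by (intro E.span_linearly_isomorphic_carrier_vec unit_endo_independent[OF nb n])
  show ?thesis
    using \<alpha> en deriv formula inner iso by blast
qed

end
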